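(* Let $m\ge 1$ be an integer and let $E: a_1x_1+\dots+a_{2m+1}x_{2m+1}=0$ be a linear equation with coefficients $a_i\in\mathbb{Z}\setminus\{0\}$ for each $i=1,\dots,2m+1$. Then $E$ is $r$-uncommon over the integers for every integer $r\ge 3$.
   Context: Write $[n]=\{1,\dots,n\}$. Let $E: a_1x_1+\dots+a_kx_k=0$ be a linear equation with nonzero integer coefficients, and let $r\ge 2$ be an integer. An $r$-coloring of $[n]$ is a map $c:[n]\to\{1,\dots,r\}$; a solution $(x_1,\dots,x_k)\in[n]^k$ of $E$ is monochromatic if $c(x_1)=\dots=c(x_k)$. The equation $E$ is $r$-common over the integers if any $r$-coloring of $[n]$ has at least as many monochromatic solutions asymptotically (as $n\to\infty$) as a uniformly random $r$-coloring; that is, the minimum over all $r$-colorings of $[n]$ of the proportion of solutions of $E$ in $[n]^k$ that are monochromatic is at least $r^{1-k}-o(1)$ as $n\to\infty$. Otherwise $E$ is $r$-uncommon over the integers. *)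

theory Defs
  imports "HOL-Analysis.Analysis"
begin

text \<open>The equation \<open>a\<^sub>1 x\<^sub>1 + \<dots> + a\<^sub>k x\<^sub>k = 0\<close> is given by its length \<open>k\<close> and a coefficient
  function \<open>a\<close>, of which only the values at \<open>1, \<dots>, k\<close> matter.\<close>

definition solutions :: "nat \<Rightarrow> (nat \<Rightarrow> int) \<Rightarrow> nat \<Rightarrow> (nat \<Rightarrow> nat) set" where
  "solutions k a n = {x \<in> {1..k} \<rightarrow>\<^sub>E {1..n}. (\<Sum>i\<in>{1..k}. a i * int (x i)) = 0}"

definition colorings :: "nat \<Rightarrow> nat \<Rightarrow> (nat \<Rightarrow> nat) set" where
  "colorings r n = {1..n} \<rightarrow>\<^sub>E {1..r}"

definition monochromatic :: "nat \<Rightarrow> (nat \<Rightarrow> nat) \<Rightarrow> (nat \<Rightarrow> nat) \<Rightarrow> bool" where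
  "monochromatic k c x \<longleftrightarrow> (\<forall>i\<in>{1..k}. \<forall>j\<in>{1..k}. c (x i) = c (x j))"

text \<open>If there is no solution in \<open>{1..n}\<close>, the proportion is \<open>0 / 0 = 0\<close>. For mixed signs and
  \<open>k \<ge> 2\<close> this affects only solution-free \<open>n\<close>, hence only finitely many \<open>n\<close>; if all
  coefficients have the same sign, it makes every proportion \<open>0\<close>.\<close>

definition mono_proportion :: "nat \<Rightarrow> (nat \<Rightarrow> int) \<Rightarrow> nat \<Rightarrow> (nat \<Rightarrow> nat) \<Rightarrow> real" where
  "mono_proportion k a n c =
     real (card {x \<in> solutions k a n. monochromatic k c x}) / real (card (solutions k a n))"

definition min_mono_proportion :: "nat \<Rightarrow> (nat \<Rightarrow> int) \<Rightarrow> nat \<Rightarrow> nat \<Rightarrow> real" where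
  "min_mono_proportion k a r n = Min (mono_proportion k a n ` colorings r n)"

text \<open>The function \<open>e\<close> is the \<open>o(1)\<close> error term.\<close>

definition common_over_integers :: "nat \<Rightarrow> nat \<Rightarrow> (nat \<Rightarrow> int) \<Rightarrow> bool" where
  "common_over_integers r k a \<longleftrightarrow>
     (\<exists>e :: nat \<Rightarrow> real. e \<longlonglongrightarrow> 0 \<and>
        (\<forall>\<^sub>F n in sequentially. min_mono_proportion k a r n \<ge> real r powi (1 - int k) - e n))"

definition uncommon_over_integers :: "nat \<Rightarrow> nat \<Rightarrow> (nat \<Rightarrow> int) \<Rightarrow> bool" where
  "uncommon_over_integers r k a \<longleftrightarrow> \<not> common_over_integers r k a"

end

theory Submission
  imports Defs
begin

text \<open>Fix \<open>p \<ge> 2\<close> coprime to all coefficients and color \<open>y\<close> at random, giving it color \<open>j\<close> with probability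
  \<open>1/r + d\<^sub>j (1\<^bsub>p dvd y\<^esub> - 1/p)\<close>, where the \<open>d\<^sub>j\<close> sum to \<open>0\<close>. For a set \<open>S\<close> of fewer than \<open>k\<close> coordinates,
  a proportion about \<open>p^(-|S|)\<close> of the solutions has all coordinates in \<open>S\<close> divisible by \<open>p\<close>, as if the
  coordinates were independent; for all \<open>k\<close> coordinates the proportion is \<open>p^(1-k)\<close>, because the last
  divisibility is automatic. Hence the expected proportion of monochromatic solutions tends to
  \<open>r^(1-k) + (p^(1-k) - p^(-k)) \<Sum>\<^sub>j d\<^sub>j^k\<close>. Since \<open>k\<close> is odd and there are three colors, the choice
  \<open>d = (\<epsilon>, \<epsilon>, -2\<epsilon>, 0, \<dots>)\<close> makes the last sum negative. If all coefficients have the same sign,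
  there are no solutions and every proportion is \<open>0\<close>.\<close>

section \<open>Upper bounds for degenerate solutions\<close>

lemma finite_solutions: "finite (solutions k a n)"
  unfolding solutions_def by (rule finite_subset[of _ "{1..k} \<rightarrow>\<^sub>E {1..n}"]) (auto intro: finite_PiE)

lemma solutions_range: "x \<in> solutions k a n \<Longrightarrow> i \<in> {1..k} \<Longrightarrow> x i \<in> {1..n}"
  unfolding solutions_def by (blast dest: PiE_mem)

text \<open>The remaining \<open>k - 2\<close> coordinates take at most \<open>n\<close> values
  each. It serves sets of solutions subject to one further linear condition, where the condition and
  the equation each determine a coordinate. This sets the error scale \<open>n ^ (k - 2)\<close>,
  one power of \<open>n\<close> below the order of the number of solutions for mixed signs.\<close>

lemma card_le_drop_two_coordinates:
  assumes "B \<subseteq> {1..k} \<rightarrow>\<^sub>E {1..n}" "i \<in> {1..k}" "l \<in> {1..k}" "i \<noteq> l"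
    and inj: "inj_on (\<lambda>x. restrict x ({1..k} - {i, l})) B"
  shows "card B \<le> n ^ (k - 2)"
proof -
  have "(\<lambda>x. restrict x ({1..k} - {i, l})) ` B \<subseteq> ({1..k} - {i, l}) \<rightarrow>\<^sub>E {1..n}"
    using assms(1) by (force simp: PiE_iff)
  then have "card B \<le> card (({1..k} - {i, l}) \<rightarrow>\<^sub>E {1..n})"
    using card_inj_on_le[OF inj] by (simp add: finite_PiE)
  also have "\<dots> = n ^ (k - 2)"
    using assms(2-4) by (simp add: card_PiE card_Diff_subset numeral_2_eq_2)
  finally show ?thesis .
qed

text \<open>Since \<open>a l\<close> is nonzero, the equation can be solved for the coordinate
  \<open>l\<close>, so the other coordinates determine the solution.\<close>

lemma solutions_eqI:
  assumes x: "x \<in> solutions k a n" and y: "y \<in> solutions k a n"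
    and l: "l \<in> {1..k}" "a l \<noteq> 0" and eq: "\<And>i. i \<in> {1..k} - {l} \<Longrightarrow> x i = y i"
  shows "x = y"
proof -
  have split: "(\<Sum>i\<in>{1..k}. a i * int (z i)) = a l * int (z l) + (\<Sum>i\<in>{1..k} - {l}. a i * int (z i))"
    for z
    using l by (intro sum.remove) auto
  have "(\<Sum>i\<in>{1..k} - {l}. a i * int (x i)) = (\<Sum>i\<in>{1..k} - {l}. a i * int (y i))"
    using eq by (intro sum.cong) auto
  then have "a l * int (x l) = a l * int (y l)"
    using x y split[of x] split[of y] unfolding solutions_def mem_Collect_eq by linarith
  then have "x l = y l" using l by simp
  then have "x i = y i" if "i \<in> {1..k}" for i
    using eq[of i] that by (cases "i = l") auto
  then show ?thesis
    using x y unfolding solutions_def by (intro PiE_ext[of x "{1..k}" "\<lambda>_. {1..n}" y]) auto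
qed

text \<open>Coordinate \<open>i\<close> is prescribed, and the equation determines a second
  coordinate \<open>l\<close> from the rest.\<close>

lemma card_solutions_fixed_coordinate:
  assumes "k \<ge> 2" "\<And>i. i \<in> {1..k} \<Longrightarrow> a i \<noteq> 0" "i \<in> {1..k}"
  shows "card {x \<in> solutions k a n. x i = v} \<le> n ^ (k - 2)"
proof -
  obtain l where l: "l \<in> {1..k}" "l \<noteq> i"
  proof (cases "i = 1")
    case True
    then show ?thesis using assms(1) that[of 2] by simp
  next
    case False
    then show ?thesis using assms(1) that[of 1] by simp
  qed
  show ?thesis
  proof (rule card_le_drop_two_coordinates[of _ k n i l])
    show "inj_on (\<lambda>x. restrict x ({1..k} - {i, l})) {x \<in> solutions k a n. x i = v}"
    proof (rule inj_onI)
      fix x y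
      assume xy: "x \<in> {x \<in> solutions k a n. x i = v}" "y \<in> {x \<in> solutions k a n. x i = v}"
        and *: "restrict x ({1..k} - {i, l}) = restrict y ({1..k} - {i, l})"
      have "x j = y j" if "j \<in> {1..k} - {l}" for j
        using fun_cong[OF *, of j] that xy by (cases "j = i") simp_all
      then show "x = y"
        using xy l assms(2) by (intro solutions_eqI[of x k a n y l]) simp_all
    qed
  qed (use l assms in \<open>auto simp: solutions_def\<close>)
qed

text \<open>The condition determines \<open>x j\<close> from \<open>x i\<close>, and the equation
  determines a third coordinate \<open>x l\<close>. Solving for \<open>x l\<close> instead of the
  common value of \<open>x i\<close> and \<open>x j\<close> also covers the case
  \<open>a i + a j = 0\<close>.\<close>

lemma card_solutions_equal_coordinates:
  assumes "k \<ge> 3" "\<And>i. i \<in> {1..k} \<Longrightarrow> a i \<noteq> 0" "i \<in> {1..k}" "j \<in> {1..k}" "i \<noteq> j"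
  shows "card {x \<in> solutions k a n. x i = x j} \<le> n ^ (k - 2)"
proof -
  have "card ({1..k} - {i, j}) > 0"
    using assms by (simp add: card_Diff_subset)
  then obtain l where l: "l \<in> {1..k}" "l \<noteq> i" "l \<noteq> j"
    unfolding card_gt_0_iff by blast
  show ?thesis
  proof (rule card_le_drop_two_coordinates[of _ k n j l])
    show "inj_on (\<lambda>x. restrict x ({1..k} - {j, l})) {x \<in> solutions k a n. x i = x j}"
    proof (rule inj_onI)
      fix x y
      assume xy: "x \<in> {x \<in> solutions k a n. x i = x j}" "y \<in> {x \<in> solutions k a n. x i = x j}"
        and *: "restrict x ({1..k} - {j, l}) = restrict y ({1..k} - {j, l})"
      have eq: "x m = y m" if "m \<in> {1..k} - {j, l}" for m
        using fun_cong[OF *, of m] that by simp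
      have "x i = y i" using eq[of i] l assms by auto
      then have "x j = y j" using xy by simp
      then have "x m = y m" if "m \<in> {1..k} - {l}" for m
        using eq[of m] that by (cases "m = j") simp_all
      then show "x = y"
        using xy l assms(2) by (intro solutions_eqI[of x k a n y l]) simp_all
    qed
  qed (use l assms in \<open>auto simp: solutions_def\<close>)
qed

text \<open>A union bound over the pairs of coordinates that may coincide. Under a random coloring
  the colors of the coordinates are independent only if the coordinates are distinct; all other
  solutions are negligible by this bound.\<close>

lemma card_not_inj_solutions:
  assumes "k \<ge> 3" "\<And>i. i \<in> {1..k} \<Longrightarrow> a i \<noteq> 0"
  shows "card {x \<in> solutions k a n. \<not> inj_on x {1..k}} \<le> k\<^sup>2 * n ^ (k - 2)"
proof -
  define I where "I = {(i, j) \<in> {1..k} \<times> {1..k}. i \<noteq> j}"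
  define T where "T = (\<lambda>(i, j). {x \<in> solutions k a n. x i = x j})"
  have I: "finite I" "card I \<le> k\<^sup>2"
  proof -
    have sub: "I \<subseteq> {1..k} \<times> {1..k}" by (auto simp: I_def)
    then show "finite I" by (rule finite_subset) auto
    have "card I \<le> card ({1..k} \<times> {1..k})"
      using sub by (intro card_mono) auto
    then show "card I \<le> k\<^sup>2" by (simp add: power2_eq_square)
  qed
  have "{x \<in> solutions k a n. \<not> inj_on x {1..k}} \<subseteq> (\<Union>q\<in>I. T q)"
    unfolding inj_on_def I_def T_def by fast
  then have "card {x \<in> solutions k a n. \<not> inj_on x {1..k}} \<le> card (\<Union>q\<in>I. T q)"
    using I by (intro card_mono) (auto simp: T_def finite_solutions split: prod.splits)
  also have "\<dots> \<le> (\<Sum>q\<in>I. card (T q))"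
    using I by (intro card_UN_le)
  also have "\<dots> \<le> (\<Sum>q\<in>I. n ^ (k - 2))"
    using assms by (intro sum_mono) (auto simp: I_def T_def intro!: card_solutions_equal_coordinates)
  also have "\<dots> \<le> k\<^sup>2 * n ^ (k - 2)"
    using I by simp
  finally show ?thesis .
qed

section \<open>Translating solutions\<close>

text \<open>Translation by an integer solution \<open>w\<close> of the equation is injective and
  preserves the equation; it fails only where it leaves \<open>{1..n}\<close>. To leave through
  coordinate \<open>i\<close>, \<open>x i\<close> must be one of at most
  \<open>\<bar>w i\<bar>\<close> values near an end of the interval, and each such value accounts
  for at most \<open>n ^ (k - 2)\<close> solutions.\<close>

lemma card_solutions_shift_le:
  assumes k: "k \<ge> 2" and nz: "\<And>i. i \<in> {1..k} \<Longrightarrow> a i \<noteq> 0"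
    and w: "(\<Sum>i\<in>{1..k}. a i * w i) = 0"
    and A: "A \<subseteq> solutions k a n" and B: "finite B"
    and AB: "\<And>x y. x \<in> A \<Longrightarrow> y \<in> solutions k a n \<Longrightarrow>
              (\<And>i. i \<in> {1..k} \<Longrightarrow> int (y i) = int (x i) + w i) \<Longrightarrow> y \<in> B"
  shows "card A \<le> card B + (\<Sum>i\<in>{1..k}. nat \<bar>w i\<bar>) * n ^ (k - 2)"
proof -
  define V where "V = (\<lambda>i. {v \<in> {1..n}. int v + w i \<notin> {1..int n}})"
  define bad where "bad = (\<Union>i\<in>{1..k}. \<Union>v\<in>V i. {x \<in> solutions k a n. x i = v})"
  define \<phi> where "\<phi> = (\<lambda>x. restrict (\<lambda>i. nat (int (x i) + w i)) {1..k})"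
  have cV: "card (V i) \<le> nat \<bar>w i\<bar>" for i
  proof (cases "w i \<ge> 0")
    case True
    have "V i \<subseteq> {n + 1 - nat (w i)..n}" using True by (auto simp: V_def)
    then have "card (V i) \<le> card {n + 1 - nat (w i)..n}" by (intro card_mono) auto
    then show ?thesis using True by simp
  next
    case False
    have "V i \<subseteq> {1..nat (- w i)}" using False by (auto simp: V_def)
    then have "card (V i) \<le> card {1..nat (- w i)}" by (intro card_mono) auto
    then show ?thesis using False by simp
  qed
  have fV: "finite (V i)" for i by (simp add: V_def)
  have "card bad \<le> (\<Sum>i\<in>{1..k}. card (\<Union>v\<in>V i. {x \<in> solutions k a n. x i = v}))"
    unfolding bad_def by (intro card_UN_le) auto
  also have "\<dots> \<le> (\<Sum>i\<in>{1..k}. nat \<bar>w i\<bar> * n ^ (k - 2))"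
  proof (rule sum_mono)
    fix i assume i: "i \<in> {1..k}"
    have "card (\<Union>v\<in>V i. {x \<in> solutions k a n. x i = v})
        \<le> (\<Sum>v\<in>V i. card {x \<in> solutions k a n. x i = v})"
      using fV by (intro card_UN_le)
    also have "\<dots> \<le> (\<Sum>v\<in>V i. n ^ (k - 2))"
      using k nz i by (intro sum_mono card_solutions_fixed_coordinate) auto
    also have "\<dots> \<le> nat \<bar>w i\<bar> * n ^ (k - 2)"
      using cV[of i] by simp
    finally show "card (\<Union>v\<in>V i. {x \<in> solutions k a n. x i = v}) \<le> nat \<bar>w i\<bar> * n ^ (k - 2)" .
  qed
  also have "\<dots> = (\<Sum>i\<in>{1..k}. nat \<bar>w i\<bar>) * n ^ (k - 2)"
    by (simp add: sum_distrib_right)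
  finally have cbad: "card bad \<le> (\<Sum>i\<in>{1..k}. nat \<bar>w i\<bar>) * n ^ (k - 2)" .
  have fbad: "finite bad"
    unfolding bad_def using fV by (auto simp: finite_solutions)
  have range: "int (x i) + w i \<in> {1..int n}" if "x \<in> A - bad" "i \<in> {1..k}" for x i
  proof (rule ccontr)
    assume "int (x i) + w i \<notin> {1..int n}"
    then have "x i \<in> V i"
      using solutions_range[of x k a n i] that A by (auto simp: V_def)
    then show False using that A by (auto simp: bad_def)
  qed
  have \<phi>: "int (\<phi> x i) = int (x i) + w i" if "x \<in> A - bad" "i \<in> {1..k}" for x i
    using range[OF that] that by (simp add: \<phi>_def)
  have "\<phi> x \<in> B" if x: "x \<in> A - bad" for x
  proof (rule AB[of x])
    have "(\<Sum>i\<in>{1..k}. a i * int (\<phi> x i)) = (\<Sum>i\<in>{1..k}. a i * int (x i) + a i * w i)"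
      using \<phi>[OF x] by (intro sum.cong) (auto simp: distrib_left)
    also have "\<dots> = 0"
      using x A w by (auto simp: sum.distrib solutions_def)
    finally show "\<phi> x \<in> solutions k a n"
      using range[OF x] by (force simp: solutions_def \<phi>_def)
  qed (use x \<phi>[OF x] in auto)
  moreover have "inj_on \<phi> (A - bad)"
  proof (rule inj_onI)
    fix x y assume xy: "x \<in> A - bad" "y \<in> A - bad" and eq: "\<phi> x = \<phi> y"
    have "x i = y i" if "i \<in> {1..k}" for i
      using \<phi>[OF xy(1) that] \<phi>[OF xy(2) that] eq by simp
    then show "x = y"
      using xy A by (intro PiE_ext[of x "{1..k}" "\<lambda>_. {1..n}" y]) (auto simp: solutions_def)
  qed
  ultimately have "card (A - bad) \<le> card B"
    using B by (intro card_inj_on_le[of \<phi>]) auto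
  moreover have "card A \<le> card (A - bad) + card bad"
    using fbad by (metis card_Un_le[of "A - bad" "A \<inter> bad"] Un_Diff_Int Int_lower2 card_mono
        add_le_cancel_left le_trans)
  ultimately show ?thesis using cbad by linarith
qed

section \<open>Solutions with coordinates divisible by p\<close>

definition div_solutions :: "nat \<Rightarrow> (nat \<Rightarrow> int) \<Rightarrow> nat \<Rightarrow> nat \<Rightarrow> nat set \<Rightarrow> (nat \<Rightarrow> nat) set" where
  "div_solutions k a n p S = {x \<in> solutions k a n. \<forall>i\<in>S. p dvd x i}"

lemma finite_div_solutions: "finite (div_solutions k a n p S)"
  by (simp add: div_solutions_def finite_solutions)

lemma div_solutions_empty [simp]: "div_solutions k a n p {} = solutions k a n"
  by (simp add: div_solutions_def)

text \<open>Shifting by a multiple of \<open>a\<^sub>l e\<^sub>i - a\<^sub>i e\<^sub>l\<close> moves \<open>x\<^sub>i\<close> from one residue class modulo \<open>p\<close>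
  to any other one without touching the coordinates in \<open>S\<close>.\<close>

lemma div_solutions_insert:
  assumes k: "k \<ge> 2" and nz: "\<And>i. i \<in> {1..k} \<Longrightarrow> a i \<noteq> 0"
    and i: "i \<in> {1..k}" "i \<notin> S" and l: "l \<in> {1..k}" "l \<notin> insert i S"
    and p: "p > 0" "coprime (a l) (int p)" and S: "S \<subseteq> {1..k}"
  shows "\<exists>C. \<forall>n. \<bar>real p * real (card (div_solutions k a n p (insert i S)))
                - real (card (div_solutions k a n p S))\<bar> \<le> C * real n ^ (k - 2)"
proof -
  obtain u v where uv: "u * a l + v * int p = 1"
    using bezout_int[of "a l" "int p"] p by (auto simp: coprime_iff_gcd_eq_1)
  \<comment> \<open>This is \<open>t * u\<close> times the vector with \<open>a l\<close> at
    \<open>i\<close> and \<open>- a i\<close> at \<open>l\<close>, which solves the equation. As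
    \<open>u\<close> inverts \<open>a l\<close> modulo \<open>p\<close>, the shift changes
    \<open>x i\<close> by \<open>t\<close> modulo \<open>p\<close>.\<close>
  define w where "w = (\<lambda>(t::int) j. if j = i then t * u * a l else if j = l then - t * u * a i else 0)"
  define A where "A = (\<lambda>n t. {x \<in> div_solutions k a n p S. x i mod p = t})"
  define c where "c = (\<lambda>t. \<Sum>j\<in>{1..k}. nat \<bar>w t j\<bar>)"
  have w0: "(\<Sum>j\<in>{1..k}. a j * w t j) = 0" for t
  proof -
    have "(\<Sum>j\<in>{1..k}. a j * w t j) = (\<Sum>j\<in>{i, l}. a j * w t j)"
      using i l by (intro sum.mono_neutral_right) (auto simp: w_def)
    also have "\<dots> = 0" using l by (simp add: w_def)
    finally show ?thesis .
  qed
  have wi: "w t i = t - t * v * int p" for t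
    using uv by (simp add: w_def) (metis (no_types, lifting) add_diff_cancel_right' mult.assoc mult.right_neutral right_diff_distrib')
  have wS: "w t j = 0" if "j \<in> S" for t j
    using that i l by (auto simp: w_def)
  have step: "card (A n s) \<le> card (A n t) + c (int t - int s) * n ^ (k - 2)"
    if st: "s < p" "t < p" for n s t
    unfolding c_def
  proof (rule card_solutions_shift_le[OF k nz w0])
    show "A n s \<subseteq> solutions k a n" by (auto simp: A_def div_solutions_def)
    show "finite (A n t)" by (simp add: A_def finite_div_solutions)
    fix x y
    assume x: "x \<in> A n s" and y: "y \<in> solutions k a n"
      and eq: "\<And>j. j \<in> {1..k} \<Longrightarrow> int (y j) = int (x j) + w (int t - int s) j"
    have "p dvd y j" if "j \<in> S" for j
      using eq[of j] wS[OF that] that S x by (auto simp: A_def div_solutions_def)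
    moreover have "y i mod p = t"
    proof -
      have "int (x i) mod int p = int s" using x by (auto simp: A_def simp flip: of_nat_mod)
      then obtain q where q: "int (x i) = int s + q * int p"
        by (metis mod_div_decomp add.commute)
      have "int (y i) = int t + (q - (int t - int s) * v) * int p"
        using eq[OF i(1)] wi[of "int t - int s"] q by (simp add: algebra_simps)
      then have "int (y i) mod int p = int t" using st by simp
      then show ?thesis by (metis of_nat_mod of_nat_eq_iff)
    qed
    ultimately show "y \<in> A n t" using y by (simp add: A_def div_solutions_def)
  qed
  \<comment> \<open>For each residue \<open>t\<close> this adds the cost of moving from class
    \<open>0\<close> to class \<open>t\<close> and that of moving back, which bounds the difference
    of the two class sizes in both directions.\<close>
  define C where "C = (\<Sum>t<p. c (int t) + c (- int t))"
  have A0: "A n 0 = div_solutions k a n p (insert i S)" for n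
    by (auto simp: A_def div_solutions_def)
  have tot: "card (div_solutions k a n p S) = (\<Sum>t<p. card (A n t))" for n
  proof -
    have "div_solutions k a n p S = (\<Union>t\<in>{..<p}. A n t)"
      using p by (auto simp: A_def)
    also have "card \<dots> = (\<Sum>t<p. card (A n t))"
      by (intro card_UN_disjoint) (auto simp: A_def finite_div_solutions)
    finally show ?thesis .
  qed
  have "\<bar>real p * real (card (A n 0)) - real (card (div_solutions k a n p S))\<bar>
          \<le> real C * real n ^ (k - 2)" for n
  proof -
    have "\<bar>real p * real (card (A n 0)) - real (card (div_solutions k a n p S))\<bar>
        = \<bar>\<Sum>t<p. real (card (A n 0)) - real (card (A n t))\<bar>"
      by (simp add: tot sum_subtractf)
    also have "\<dots> \<le> (\<Sum>t<p. \<bar>real (card (A n 0)) - real (card (A n t))\<bar>)"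
      by (rule sum_abs)
    also have "\<dots> \<le> (\<Sum>t<p. real (c (int t) + c (- int t)) * real n ^ (k - 2))"
    proof (rule sum_mono)
      fix t assume "t \<in> {..<p}"
      then have "real (card (A n 0)) \<le> real (card (A n t)) + real (c (int t)) * real n ^ (k - 2)"
        and "real (card (A n t)) \<le> real (card (A n 0)) + real (c (- int t)) * real n ^ (k - 2)"
        using step[of 0 t n] step[of t 0 n] p by (simp_all flip: of_nat_power of_nat_mult of_nat_add)
      moreover have "real (c (int t)) * real n ^ (k - 2) \<ge> 0" "real (c (- int t)) * real n ^ (k - 2) \<ge> 0"
        by auto
      ultimately show "\<bar>real (card (A n 0)) - real (card (A n t))\<bar>
          \<le> real (c (int t) + c (- int t)) * real n ^ (k - 2)"
        unfolding of_nat_add distrib_right abs_le_iff by linarith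
    qed
    also have "\<dots> = real C * real n ^ (k - 2)"
      by (simp add: C_def sum_distrib_right)
    finally show ?thesis .
  qed
  then show ?thesis unfolding A0 by blast
qed

text \<open>Induction on \<open>S\<close>: each further divisibility condition divides the count by
  \<open>p\<close> up to the error. As \<open>S\<close> is a proper subset, there is always a
  coordinate \<open>l\<close> outside that can absorb the shift.\<close>

lemma div_solutions_proper:
  assumes k: "k \<ge> 2" and nz: "\<And>i. i \<in> {1..k} \<Longrightarrow> a i \<noteq> 0"
    and p: "p > 0" "\<And>i. i \<in> {1..k} \<Longrightarrow> coprime (a i) (int p)" and S: "S \<subset> {1..k}"
  shows "\<exists>C. \<forall>n. \<bar>real p ^ card S * real (card (div_solutions k a n p S))
                - real (card (solutions k a n))\<bar> \<le> C * real n ^ (k - 2)"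
proof -
  have "finite S" using S by (meson finite_atLeastAtMost finite_subset psubset_imp_subset)
  then show ?thesis using S
  proof (induction S rule: finite_induct)
    case empty
    show ?case by (auto intro!: exI[of _ 0])
  next
    case (insert i S)
    then obtain l where l: "l \<in> {1..k}" "l \<notin> insert i S" by blast
    obtain C1 where C1: "\<And>n. \<bar>real p ^ card S * real (card (div_solutions k a n p S))
                - real (card (solutions k a n))\<bar> \<le> C1 * real n ^ (k - 2)"
      using insert by blast
    have "\<exists>C. \<forall>n. \<bar>real p * real (card (div_solutions k a n p (insert i S)))
                - real (card (div_solutions k a n p S))\<bar> \<le> C * real n ^ (k - 2)"
      using insert k nz p l by (intro div_solutions_insert[where l = l]) auto
    then obtain C2 where C2: "\<And>n. \<bar>real p * real (card (div_solutions k a n p (insert i S)))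
                - real (card (div_solutions k a n p S))\<bar> \<le> C2 * real n ^ (k - 2)" by blast
    have "\<bar>real p ^ card (insert i S) * real (card (div_solutions k a n p (insert i S)))
                - real (card (solutions k a n))\<bar> \<le> (real p ^ card S * C2 + C1) * real n ^ (k - 2)" for n
    proof -
      let ?D = "\<lambda>S. real (card (div_solutions k a n p S))"
      have "\<bar>real p ^ card (insert i S) * ?D (insert i S) - real (card (solutions k a n))\<bar>
          = \<bar>real p ^ card S * (real p * ?D (insert i S) - ?D S)
             + (real p ^ card S * ?D S - real (card (solutions k a n)))\<bar>"
        using insert by (simp add: algebra_simps)
      also have "\<dots> \<le> real p ^ card S * \<bar>real p * ?D (insert i S) - ?D S\<bar>
             + \<bar>real p ^ card S * ?D S - real (card (solutions k a n))\<bar>"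
        by (rule order_trans[OF abs_triangle_ineq]) (simp add: abs_mult)
      also have "\<dots> \<le> real p ^ card S * (C2 * real n ^ (k - 2)) + C1 * real n ^ (k - 2)"
        by (intro add_mono mult_left_mono C1 C2) auto
      finally show ?thesis by (simp add: algebra_simps)
    qed
    then show ?case by blast
  qed
qed

text \<open>The main-term proportion of solutions lying in \<open>div_solutions k a n p S\<close>
  when \<open>p\<close> is coprime to all coefficients. The exponent \<open>k - 1\<close> for the
  full set, in place of \<open>k\<close>, records the dependence between the coordinates that the
  equation imposes.\<close>

definition div_density :: "nat \<Rightarrow> nat \<Rightarrow> nat set \<Rightarrow> real" where
  "div_density k p S = (if S = {1..k} then 1 / real p ^ (k - 1) else 1 / real p ^ card S)"

text \<open>If \<open>p\<close> divides all other coordinates, the equation shows that it divides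
  \<open>a l * int (x l)\<close>, and \<open>a l\<close> is coprime to \<open>p\<close>.\<close>

lemma div_solutions_all:
  assumes p: "coprime (a l) (int p)" and l: "l \<in> {1..k}"
  shows "div_solutions k a n p {1..k} = div_solutions k a n p ({1..k} - {l})"
proof -
  have "p dvd x l" if x: "x \<in> solutions k a n" and d: "\<forall>i\<in>{1..k} - {l}. p dvd x i" for x
  proof -
    have "a l * int (x l) + (\<Sum>i\<in>{1..k} - {l}. a i * int (x i)) = 0"
      using x l sum.remove[of "{1..k}" l "\<lambda>i. a i * int (x i)"] by (simp add: solutions_def)
    moreover have "int p dvd (\<Sum>i\<in>{1..k} - {l}. a i * int (x i))"
      using d by (intro dvd_sum dvd_mult) auto
    ultimately have "int p dvd a l * int (x l)"
      by (metis dvd_add_left_iff dvd_0_right)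
    then show ?thesis
      using p by (simp add: coprime_commute coprime_dvd_mult_right_iff)
  qed
  then show ?thesis by (force simp: div_solutions_def)
qed

lemma card_div_solutions:
  assumes k: "k \<ge> 2" and nz: "\<And>i. i \<in> {1..k} \<Longrightarrow> a i \<noteq> 0"
    and p: "p > 0" "\<And>i. i \<in> {1..k} \<Longrightarrow> coprime (a i) (int p)" and S: "S \<subseteq> {1..k}"
  shows "\<exists>C. \<forall>n. \<bar>real (card (div_solutions k a n p S))
                - div_density k p S * real (card (solutions k a n))\<bar> \<le> C * real n ^ (k - 2)"
proof -
  \<comment> \<open>The full set is replaced by a proper subset with the same solutions, by dropping
    coordinate \<open>1\<close>, whose divisibility is automatic.\<close>
  define S' where "S' = (if S = {1..k} then {1..k} - {1} else S)"
  have S': "S' \<subset> {1..k}" using S k by (auto simp: S'_def)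
  have D: "div_solutions k a n p S = div_solutions k a n p S'" for n
    using div_solutions_all[of a 1 p k n] p k by (auto simp: S'_def)
  have dens: "div_density k p S = 1 / real p ^ card S'"
    using k by (auto simp: div_density_def S'_def)
  obtain C where C: "\<And>n. \<bar>real p ^ card S' * real (card (div_solutions k a n p S'))
                - real (card (solutions k a n))\<bar> \<le> C * real n ^ (k - 2)"
    using div_solutions_proper[of k a p S'] k nz p S' by blast
  have "\<bar>real (card (div_solutions k a n p S))
                - div_density k p S * real (card (solutions k a n))\<bar> \<le> C / real p ^ card S' * real n ^ (k - 2)" for n
  proof -
    have "real (card (div_solutions k a n p S)) - div_density k p S * real (card (solutions k a n))
      = (real p ^ card S' * real (card (div_solutions k a n p S')) - real (card (solutions k a n))) / real p ^ card S'"
      using p by (simp add: D dens field_simps)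
    then have "\<bar>real (card (div_solutions k a n p S)) - div_density k p S * real (card (solutions k a n))\<bar>
      = \<bar>real p ^ card S' * real (card (div_solutions k a n p S')) - real (card (solutions k a n))\<bar> / real p ^ card S'"
      by (simp add: abs_divide)
    also have "\<dots> \<le> C * real n ^ (k - 2) / real p ^ card S'"
      by (intro divide_right_mono C) auto
    finally show ?thesis by simp
  qed
  then show ?thesis by blast
qed

section \<open>Weighted counts of solutions\<close>

text \<open>With density \<open>1 / real p ^ card S\<close> for every \<open>S\<close> this would be
  the binomial theorem. The excess density of the full set adds the second term, from which the
  deviation from random colorings comes.\<close>

lemma sum_div_density:
  fixes \<beta> d :: real
  assumes "k \<ge> 1"
  shows "(\<Sum>S\<in>Pow {1..k}. d ^ card S * \<beta> ^ (k - card S) * div_density k p S)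
       = (\<beta> + d / real p) ^ k + d ^ k * (1 / real p ^ (k - 1) - 1 / real p ^ k)"
proof -
  have "(\<beta> + d / real p) ^ k = (\<Prod>i\<in>{1..k}. d / real p + \<beta>)"
    by (simp add: add.commute)
  also have "\<dots> = (\<Sum>S\<in>Pow {1..k}. (d / real p) ^ card S * \<beta> ^ (k - card S))"
    by (subst prod_add) (auto intro!: sum.cong simp: card_Diff_subset finite_subset)
  finally have eq: "(\<beta> + d / real p) ^ k = (\<Sum>S\<in>Pow {1..k}. (d / real p) ^ card S * \<beta> ^ (k - card S))" .
  have "(\<Sum>S\<in>Pow {1..k}. d ^ card S * \<beta> ^ (k - card S) * div_density k p S)
      = (\<Sum>S\<in>Pow {1..k}. (d / real p) ^ card S * \<beta> ^ (k - card S)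
          + (if S = {1..k} then d ^ k * (1 / real p ^ (k - 1) - 1 / real p ^ k) else 0))"
    by (intro sum.cong) (auto simp: div_density_def power_divide algebra_simps)
  also have "\<dots> = (\<beta> + d / real p) ^ k + d ^ k * (1 / real p ^ (k - 1) - 1 / real p ^ k)"
    unfolding sum.distrib eq by simp
  finally show ?thesis .
qed

text \<open>Expanding the product over the set \<open>S\<close> of coordinates that contribute
  \<open>d\<close> turns the sum into a combination of the counts of \<open>div_solutions\<close>.
  For distinct coordinates the product is the probability that the solution is entirely of one
  color, where \<open>y\<close> gets that color with probability \<open>\<beta>\<close>, plus
  \<open>d\<close> if \<open>p\<close> divides \<open>y\<close>.\<close>

lemma weighted_solutions:
  fixes \<beta> d :: real
  assumes k: "k \<ge> 2" and nz: "\<And>i. i \<in> {1..k} \<Longrightarrow> a i \<noteq> 0"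
    and p: "p > 0" "\<And>i. i \<in> {1..k} \<Longrightarrow> coprime (a i) (int p)"
  shows "\<exists>C. \<forall>n. (\<Sum>x\<in>solutions k a n. \<Prod>i\<in>{1..k}. \<beta> + (if p dvd x i then d else 0))
     \<le> ((\<beta> + d / real p) ^ k + d ^ k * (1 / real p ^ (k - 1) - 1 / real p ^ k)) * real (card (solutions k a n))
        + C * real n ^ (k - 2)"
proof -
  let ?K = "{1..k}"
  obtain C where C: "\<And>S n. S \<subseteq> ?K \<Longrightarrow> \<bar>real (card (div_solutions k a n p S))
                - div_density k p S * real (card (solutions k a n))\<bar> \<le> C S * real n ^ (k - 2)"
  proof -
    have "\<forall>S\<in>Pow ?K. \<exists>C. \<forall>n. \<bar>real (card (div_solutions k a n p S))
                - div_density k p S * real (card (solutions k a n))\<bar> \<le> C * real n ^ (k - 2)"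
      using card_div_solutions[of k a p] k nz p by blast
    from bchoice[OF this] show ?thesis using that by auto
  qed
  define \<gamma> where "\<gamma> = (\<lambda>S :: nat set. d ^ card S * \<beta> ^ (k - card S))"
  have expand: "(\<Prod>i\<in>?K. \<beta> + (if p dvd x i then d else 0))
      = (\<Sum>S\<in>Pow ?K. \<gamma> S * (if \<forall>i\<in>S. p dvd x i then 1 else 0))" for x :: "nat \<Rightarrow> nat"
  proof -
    have "(\<Prod>i\<in>?K. \<beta> + (if p dvd x i then d else 0)) = (\<Prod>i\<in>?K. (if p dvd x i then d else 0) + \<beta>)"
      by (simp add: add.commute)
    also have "\<dots> = (\<Sum>S\<in>Pow ?K. (\<Prod>i\<in>S. if p dvd x i then d else 0) * (\<Prod>i\<in>?K - S. \<beta>))"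
      by (rule prod_add) simp
    also have "\<dots> = (\<Sum>S\<in>Pow ?K. \<gamma> S * (if \<forall>i\<in>S. p dvd x i then 1 else 0))"
    proof (rule sum.cong)
      fix S assume "S \<in> Pow ?K"
      then have S: "S \<subseteq> ?K" "finite S" by (auto intro: finite_subset)
      have "(\<Prod>i\<in>S. if p dvd x i then d else 0) = (if \<forall>i\<in>S. p dvd x i then d ^ card S else 0)"
        using S by (auto intro: prod_zero)
      then show "(\<Prod>i\<in>S. if p dvd x i then d else 0) * (\<Prod>i\<in>?K - S. \<beta>)
          = \<gamma> S * (if \<forall>i\<in>S. p dvd x i then 1 else 0)"
        using S by (simp add: \<gamma>_def card_Diff_subset)
    qed simp
    finally show ?thesis .
  qed
  have "(\<Sum>x\<in>solutions k a n. \<Prod>i\<in>?K. \<beta> + (if p dvd x i then d else 0))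
     \<le> ((\<beta> + d / real p) ^ k + d ^ k * (1 / real p ^ (k - 1) - 1 / real p ^ k)) * real (card (solutions k a n))
        + (\<Sum>S\<in>Pow ?K. \<bar>\<gamma> S\<bar> * C S) * real n ^ (k - 2)" for n
  proof -
    let ?N = "real (card (solutions k a n))" and ?D = "\<lambda>S. real (card (div_solutions k a n p S))"
    have "(\<Sum>x\<in>solutions k a n. \<Prod>i\<in>?K. \<beta> + (if p dvd x i then d else 0))
        = (\<Sum>S\<in>Pow ?K. \<Sum>x\<in>solutions k a n. \<gamma> S * (if \<forall>i\<in>S. p dvd x i then 1 else 0))"
      unfolding expand by (rule sum.swap)
    also have "\<dots> = (\<Sum>S\<in>Pow ?K. \<gamma> S * ?D S)"
      by (simp add: div_solutions_def finite_solutions flip: sum_distrib_left sum.inter_filter)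
    \<comment> \<open>The coefficient \<open>\<gamma> S\<close> may be negative, so the count is
      estimated from both sides and its error enters with weight
      \<open>\<bar>\<gamma> S\<bar>\<close>.\<close>
    also have "\<dots> \<le> (\<Sum>S\<in>Pow ?K. \<gamma> S * div_density k p S * ?N + \<bar>\<gamma> S\<bar> * C S * real n ^ (k - 2))"
    proof (rule sum_mono)
      fix S assume "S \<in> Pow ?K"
      then have "\<bar>\<gamma> S\<bar> * \<bar>?D S - div_density k p S * ?N\<bar> \<le> \<bar>\<gamma> S\<bar> * (C S * real n ^ (k - 2))"
        using C by (intro mult_left_mono) auto
      moreover have "\<gamma> S * (?D S - div_density k p S * ?N) \<le> \<bar>\<gamma> S\<bar> * \<bar>?D S - div_density k p S * ?N\<bar>"
        by (metis abs_ge_self abs_mult)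
      ultimately show "\<gamma> S * ?D S \<le> \<gamma> S * div_density k p S * ?N + \<bar>\<gamma> S\<bar> * C S * real n ^ (k - 2)"
        by (simp add: algebra_simps)
    qed
    also have "\<dots> = (\<Sum>S\<in>Pow ?K. \<gamma> S * div_density k p S) * ?N
        + (\<Sum>S\<in>Pow ?K. \<bar>\<gamma> S\<bar> * C S) * real n ^ (k - 2)"
      by (simp only: sum.distrib sum_distrib_right)
    also have "(\<Sum>S\<in>Pow ?K. \<gamma> S * div_density k p S)
        = (\<beta> + d / real p) ^ k + d ^ k * (1 / real p ^ (k - 1) - 1 / real p ^ k)"
      unfolding \<gamma>_def using k by (intro sum_div_density) simp
    finally show ?thesis .
  qed
  then show ?thesis by blast
qed

section \<open>Random colorings\<close>

text \<open>First moment method: give each \<open>y\<close> independently color \<open>j\<close>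
  with probability \<open>w y j\<close>. The right-hand side is the expected number of monochromatic
  solutions, and some coloring does not exceed the expectation. The product runs over the image of
  \<open>x\<close> because a repeated value is colored only once.\<close>

lemma exists_coloring_le_average:
  fixes w :: "nat \<Rightarrow> nat \<Rightarrow> real"
  assumes k: "k \<ge> 1"
    and w0: "\<And>y j. y \<in> {1..n} \<Longrightarrow> j \<in> {1..r} \<Longrightarrow> w y j \<ge> 0"
    and w1: "\<And>y. y \<in> {1..n} \<Longrightarrow> (\<Sum>j\<in>{1..r}. w y j) = 1"
  shows "\<exists>c\<in>colorings r n. real (card {x \<in> solutions k a n. monochromatic k c x})
           \<le> (\<Sum>x\<in>solutions k a n. \<Sum>j\<in>{1..r}. \<Prod>y\<in>x ` {1..k}. w y j)"
proof (rule ccontr)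
  let ?K = "{1..k}" and ?avg = "\<Sum>x\<in>solutions k a n. \<Sum>j\<in>{1..r}. \<Prod>y\<in>x ` {1..k}. w y j"
  let ?cnt = "\<lambda>c. real (card {x \<in> solutions k a n. monochromatic k c x})"
  define P where "P = (\<lambda>c. \<Prod>y\<in>{1..n}. w y (c y))"
  assume "\<not> ?thesis"
  then have big: "?avg < ?cnt c" if "c \<in> colorings r n" for c
    using that by force
  have fin: "finite (colorings r n)"
    by (simp add: colorings_def finite_PiE)
  have P0: "P c \<ge> 0" if "c \<in> colorings r n" for c
    using that w0 unfolding P_def colorings_def by (intro prod_nonneg) (auto simp: PiE_iff)
  have P1: "(\<Sum>c\<in>colorings r n. P c) = 1"
  proof -
    have "(\<Sum>c\<in>colorings r n. P c) = (\<Prod>y\<in>{1..n}. \<Sum>j\<in>{1..r}. w y j)"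
      unfolding P_def colorings_def by (rule prod_sum_PiE[symmetric]) auto
    also have "\<dots> = 1" using w1 by (intro prod.neutral) auto
    finally show ?thesis .
  qed
  \<comment> \<open>The probability that \<open>x\<close> is monochromatic.\<close>
  have one: "(\<Sum>c\<in>colorings r n. P c * (if monochromatic k c x then 1 else 0))
      = (\<Sum>j\<in>{1..r}. \<Prod>y\<in>x ` ?K. w y j)" if x: "x \<in> solutions k a n" for x
  proof -
    have xr: "x ` ?K \<subseteq> {1..n}" using solutions_range[OF x] by blast
    \<comment> \<open>For each color \<open>j\<close>, the indicator that all coordinates of
      \<open>x\<close> have color \<open>j\<close> is written as a product over all
      \<open>y\<close>, so that it merges with the product \<open>P c\<close>.\<close>
    have mono: "(if monochromatic k c x then 1 else 0)
        = (\<Sum>j\<in>{1..r}. \<Prod>y\<in>{1..n}. if y \<in> x ` ?K \<and> c y \<noteq> j then 0 else 1 :: real)"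
      if c: "c \<in> colorings r n" for c
    proof -
      have iff: "(\<Prod>y\<in>{1..n}. if y \<in> x ` ?K \<and> c y \<noteq> j then 0 else 1 :: real)
          = (if monochromatic k c x \<and> j = c (x 1) then 1 else 0)" for j
      proof (cases "\<exists>y\<in>{1..n}. y \<in> x ` ?K \<and> c y \<noteq> j")
        case True
        then obtain i where i: "i \<in> ?K" "c (x i) \<noteq> j" by blast
        have "c (x i) = c (x 1)" if "monochromatic k c x"
          using that i k unfolding monochromatic_def by (meson atLeastAtMost_iff order_refl)
        then have "\<not> (monochromatic k c x \<and> j = c (x 1))"
          using i by blast
        moreover have "(\<Prod>y\<in>{1..n}. if y \<in> x ` ?K \<and> c y \<noteq> j then 0 else 1 :: real) = 0"
          using True by (intro prod_zero) auto
        ultimately show ?thesis by (simp only: if_False)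
      next
        case False
        then have "c (x i) = j" if "i \<in> ?K" for i
          using xr that by blast
        then have "monochromatic k c x \<and> j = c (x 1)"
          using k by (auto simp: monochromatic_def)
        moreover have "(\<Prod>y\<in>{1..n}. if y \<in> x ` ?K \<and> c y \<noteq> j then 0 else 1 :: real) = 1"
          using False by (intro prod.neutral) auto
        ultimately show ?thesis by (simp only: if_True simp_thms)
      qed
      have "c (x 1) \<in> {1..r}"
        using c solutions_range[OF x, of 1] k by (auto simp: colorings_def PiE_iff)
      then have "(\<Sum>j\<in>{1..r}. if monochromatic k c x \<and> j = c (x 1) then 1 else 0 :: real)
          = (if monochromatic k c x then 1 else 0)"
        by (cases "monochromatic k c x") simp_all
      then show ?thesis unfolding iff by simp
    qed
    have "(\<Sum>c\<in>colorings r n. P c * (if monochromatic k c x then 1 else 0))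
        = (\<Sum>c\<in>colorings r n. \<Sum>j\<in>{1..r}. \<Prod>y\<in>{1..n}. w y (c y) * (if y \<in> x ` ?K \<and> c y \<noteq> j then 0 else 1))"
      by (intro sum.cong refl) (simp only: mono P_def sum_distrib_left prod.distrib)
    also have "\<dots> = (\<Sum>j\<in>{1..r}. \<Sum>c\<in>colorings r n. \<Prod>y\<in>{1..n}. w y (c y) * (if y \<in> x ` ?K \<and> c y \<noteq> j then 0 else 1))"
      by (rule sum.swap)
    also have "\<dots> = (\<Sum>j\<in>{1..r}. \<Prod>y\<in>x ` ?K. w y j)"
    proof (rule sum.cong)
      fix j assume j: "j \<in> {1..r}"
      \<comment> \<open>The sum over colorings factors over \<open>y\<close>. A value outside the
        image of \<open>x\<close> contributes its total probability \<open>1\<close>, a value in the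
        image only \<open>w y j\<close>.\<close>
      have "(\<Sum>c\<in>colorings r n. \<Prod>y\<in>{1..n}. w y (c y) * (if y \<in> x ` ?K \<and> c y \<noteq> j then 0 else 1))
          = (\<Prod>y\<in>{1..n}. \<Sum>l\<in>{1..r}. w y l * (if y \<in> x ` ?K \<and> l \<noteq> j then 0 else 1))"
        unfolding colorings_def
        by (rule prod_sum_PiE[symmetric, where f = "\<lambda>y l. w y l * (if y \<in> x ` ?K \<and> l \<noteq> j then 0 else 1)"]) auto
      also have "\<dots> = (\<Prod>y\<in>{1..n}. if y \<in> x ` ?K then w y j else 1)"
      proof (rule prod.cong)
        fix y assume y: "y \<in> {1..n}"
        show "(\<Sum>l\<in>{1..r}. w y l * (if y \<in> x ` ?K \<and> l \<noteq> j then 0 else 1)) = (if y \<in> x ` ?K then w y j else 1)"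
        proof (cases "y \<in> x ` ?K")
          case True
          then have "(\<Sum>l\<in>{1..r}. w y l * (if y \<in> x ` ?K \<and> l \<noteq> j then 0 else 1))
              = (\<Sum>l\<in>{1..r}. if l = j then w y l else 0)"
            by (intro sum.cong) auto
          then show ?thesis using True j by simp
        next
          case False
          then show ?thesis using w1[OF y] by simp
        qed
      qed simp
      also have "\<dots> = (\<Prod>y\<in>x ` ?K. w y j)"
        using xr by (simp add: prod.If_cases Int_absorb1)
      finally show "(\<Sum>c\<in>colorings r n. \<Prod>y\<in>{1..n}. w y (c y) * (if y \<in> x ` ?K \<and> c y \<noteq> j then 0 else 1))
          = (\<Prod>y\<in>x ` ?K. w y j)" .
    qed simp
    finally show ?thesis .
  qed
  have "(\<Sum>c\<in>colorings r n. P c * ?cnt c)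
      = (\<Sum>c\<in>colorings r n. \<Sum>x\<in>solutions k a n. P c * (if monochromatic k c x then 1 else 0))"
    by (simp add: finite_solutions flip: sum_distrib_left sum.inter_filter)
  also have "\<dots> = (\<Sum>x\<in>solutions k a n. \<Sum>c\<in>colorings r n. P c * (if monochromatic k c x then 1 else 0))"
    by (rule sum.swap)
  also have "\<dots> = ?avg"
    by (intro sum.cong refl one)
  finally have avg: "(\<Sum>c\<in>colorings r n. P c * ?cnt c) = ?avg" .
  \<comment> \<open>A coloring of positive probability makes the comparison of the averages
    strict.\<close>
  obtain c0 where c0: "c0 \<in> colorings r n" "P c0 > 0"
  proof -
    have "\<exists>c\<in>colorings r n. P c \<noteq> 0"
      using P1 by (metis sum.neutral zero_neq_one)
    then show ?thesis using P0 that by force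
  qed
  have "(\<Sum>c\<in>colorings r n. P c * ?avg) < (\<Sum>c\<in>colorings r n. P c * ?cnt c)"
    using c0 P0 big fin
    by (intro sum_strict_mono_ex1) (auto intro: mult_left_mono less_imp_le intro!: bexI[of _ c0])
  then show False using avg P1 by (simp flip: sum_distrib_right)
qed

text \<open>Products over values and over coordinates agree for solutions with distinct coordinates.
  For any other solution the two sums over the colors differ by at most \<open>1\<close> in the
  unfavorable direction, and there are at most \<open>k\<^sup>2 * n ^ (k - 2)\<close> of
  these.\<close>

lemma exists_coloring_weighted:
  fixes w :: "nat \<Rightarrow> nat \<Rightarrow> real"
  assumes k: "k \<ge> 3" and nz: "\<And>i. i \<in> {1..k} \<Longrightarrow> a i \<noteq> 0"
    and w0: "\<And>y j. j \<in> {1..r} \<Longrightarrow> w y j \<ge> 0"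
    and w1: "\<And>y. (\<Sum>j\<in>{1..r}. w y j) = 1"
  shows "\<exists>c\<in>colorings r n. real (card {x \<in> solutions k a n. monochromatic k c x})
           \<le> (\<Sum>j\<in>{1..r}. \<Sum>x\<in>solutions k a n. \<Prod>i\<in>{1..k}. w (x i) j) + real (k\<^sup>2) * real n ^ (k - 2)"
proof -
  let ?K = "{1..k}"
  have le1: "w y j \<le> 1" if "j \<in> {1..r}" for y j
  proof -
    have "w y j \<le> (\<Sum>j\<in>{1..r}. w y j)"
      using w0 that by (intro member_le_sum) auto
    then show ?thesis using w1 by simp
  qed
  have bound: "(\<Sum>j\<in>{1..r}. \<Prod>y\<in>x ` ?K. w y j)
      \<le> (\<Sum>j\<in>{1..r}. \<Prod>i\<in>?K. w (x i) j) + (if inj_on x ?K then 0 else 1)" for x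
  proof (cases "inj_on x ?K")
    case True
    then show ?thesis by (simp add: prod.reindex)
  next
    case False
    \<comment> \<open>All weights are at most \<open>1\<close>, so a single factor bounds the
      product; summed over the colors these factors give \<open>1\<close>.\<close>
    have "(\<Prod>y\<in>x ` ?K. w y j) \<le> w (x 1) j" if "j \<in> {1..r}" for j
    proof -
      have "(\<Prod>y\<in>x ` ?K. w y j) = w (x 1) j * (\<Prod>y\<in>x ` ?K - {x 1}. w y j)"
        using k by (intro prod.remove) auto
      also have "\<dots> \<le> w (x 1) j"
        using that w0 le1 by (intro mult_left_le prod_le_1) auto
      finally show ?thesis .
    qed
    then have "(\<Sum>j\<in>{1..r}. \<Prod>y\<in>x ` ?K. w y j) \<le> (\<Sum>j\<in>{1..r}. w (x 1) j)"
      by (rule sum_mono)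
    moreover have "(\<Sum>j\<in>{1..r}. \<Prod>i\<in>?K. w (x i) j) \<ge> 0"
      using w0 by (intro sum_nonneg prod_nonneg) auto
    ultimately show ?thesis using False w1 by simp
  qed
  obtain c where c: "c \<in> colorings r n"
    and "real (card {x \<in> solutions k a n. monochromatic k c x})
           \<le> (\<Sum>x\<in>solutions k a n. \<Sum>j\<in>{1..r}. \<Prod>y\<in>x ` ?K. w y j)"
    using exists_coloring_le_average[of k n r w a] k w0 w1 by auto
  note this(2)
  also have "(\<Sum>x\<in>solutions k a n. \<Sum>j\<in>{1..r}. \<Prod>y\<in>x ` ?K. w y j)
      \<le> (\<Sum>x\<in>solutions k a n. (\<Sum>j\<in>{1..r}. \<Prod>i\<in>?K. w (x i) j) + (if inj_on x ?K then 0 else 1))"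
    by (intro sum_mono bound)
  also have "\<dots> = (\<Sum>j\<in>{1..r}. \<Sum>x\<in>solutions k a n. \<Prod>i\<in>?K. w (x i) j)
      + real (card {x \<in> solutions k a n. \<not> inj_on x ?K})"
  proof -
    have "(\<Sum>x\<in>solutions k a n. if inj_on x ?K then 0 else 1 :: real)
        = (\<Sum>x\<in>solutions k a n. if \<not> inj_on x ?K then 1 else 0)"
      by (intro sum.cong) auto
    also have "\<dots> = real (card {x \<in> solutions k a n. \<not> inj_on x ?K})"
      by (simp only: sum.inter_filter[OF finite_solutions, symmetric]) simp
    finally show ?thesis
      by (simp only: sum.distrib) (subst sum.swap, simp)
  qed
  also have "\<dots> \<le> (\<Sum>j\<in>{1..r}. \<Sum>x\<in>solutions k a n. \<Prod>i\<in>?K. w (x i) j) + real (k\<^sup>2) * real n ^ (k - 2)"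
    using of_nat_mono[OF card_not_inj_solutions[of k a n], where 'a = real] k nz by simp
  finally show ?thesis using c by blast
qed

section \<open>Many solutions for mixed signs\<close>

text \<open>After choosing \<open>x\<^sub>l = a\<^sub>i y\<^sub>l\<close> for \<open>l \<noteq> i, j\<close> and \<open>x\<^sub>j = a\<^sub>i t\<close>, the equation determines an integer \<open>x\<^sub>i\<close>,
  which is positive as soon as \<open>t\<close> is large compared with the \<open>y\<^sub>l\<close>.\<close>

lemma card_solutions_lower:
  assumes i: "i \<in> {1..k}" "a i > 0" and j: "j \<in> {1..k}" "a j < 0"
  shows "\<exists>N>0. \<forall>h. h ^ (k - 1) \<le> card (solutions k a (N * h))"
proof -
  let ?K = "{1..k}"
  define B where "B = (\<Sum>l\<in>?K. \<bar>a l\<bar>)"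
  have B: "\<bar>a l\<bar> \<le> B" if "l \<in> ?K" for l
    unfolding B_def using that by (intro member_le_sum) auto
  have ij: "i \<noteq> j" using i j by auto
  have B1: "a i \<le> B" "- a j \<le> B" "B \<ge> 1"
    using B[OF i(1)] B[OF j(1)] i j by auto
  \<comment> \<open>An upper bound, per unit of \<open>h\<close>, for all coordinates constructed
    below: \<open>t\<close> is at most \<open>(B + 1) * int h\<close>, its coefficient at most
    \<open>B\<close>, and the remaining sum adds at most \<open>B * int h\<close>.\<close>
  define N where "N = nat (B * (B + 1) + B)"
  have N: "int N = B * (B + 1) + B" "N > 0"
  proof -
    have "B * (B + 1) \<ge> 0" using B1(3) by auto
    then have "B * (B + 1) + B > 0" using B1(3) by linarith
    then show "int N = B * (B + 1) + B" "N > 0" unfolding N_def by linarith+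
  qed
  have "h ^ (k - 1) \<le> card (solutions k a (N * h))" for h
  proof -
    define Y where "Y = (?K - {i}) \<rightarrow>\<^sub>E {1..h}"
    \<comment> \<open>The offset \<open>B * int h\<close> dominates \<open>s y\<close>, so that
      coordinate \<open>i\<close> below is at least \<open>t y - s y \<ge> 1\<close>, while
      \<open>y j\<close> can still be recovered.\<close>
    define t where "t = (\<lambda>y :: nat \<Rightarrow> nat. B * int h + int (y j))"
    define s where "s = (\<lambda>y :: nat \<Rightarrow> nat. \<Sum>l\<in>?K - {i, j}. a l * int (y l))"
    define z where "z = (\<lambda>y l. if l = i then - a j * t y - s y
      else if l = j then a i * t y else a i * int (y l))"
    define \<phi> where "\<phi> = (\<lambda>y. restrict (\<lambda>l. nat (z y l)) ?K)"
    have y: "1 \<le> y l" "y l \<le> h" if "y \<in> Y" "l \<in> ?K" "l \<noteq> i" for y l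
      using that by (auto simp: Y_def PiE_iff)
    have s: "\<bar>s y\<bar> \<le> B * int h" if "y \<in> Y" for y
    proof -
      have "\<bar>s y\<bar> \<le> (\<Sum>l\<in>?K - {i, j}. \<bar>a l * int (y l)\<bar>)"
        unfolding s_def by (rule sum_abs)
      also have "\<dots> \<le> (\<Sum>l\<in>?K - {i, j}. \<bar>a l\<bar> * int h)"
        using y[OF that] by (intro sum_mono) (auto simp: abs_mult intro!: mult_left_mono)
      also have "\<dots> \<le> (\<Sum>l\<in>?K. \<bar>a l\<bar> * int h)"
        by (intro sum_mono2) auto
      finally show ?thesis by (simp add: B_def sum_distrib_right)
    qed
    have t: "B * int h + 1 \<le> t y" "t y \<le> (B + 1) * int h" if "y \<in> Y" for y
      using y[OF that j(1)] ij by (auto simp: t_def algebra_simps)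
    have z: "1 \<le> z y l" "z y l \<le> int (N * h)" if yY: "y \<in> Y" and l: "l \<in> ?K" for y l
    proof -
      have t0: "t y \<ge> 1"
        using t(1)[OF yY] B1 by (smt (verit) mult_nonneg_nonneg of_nat_0_le_iff)
      have Bt: "B * t y \<le> B * ((B + 1) * int h)"
        using t(2)[OF yY] B1 by (intro mult_left_mono) auto
      have Nh: "int (N * h) = B * ((B + 1) * int h) + B * int h"
        using N by (simp add: algebra_simps)
      have Bh: "B * int h \<ge> 0" "B * ((B + 1) * int h) \<ge> 0" using B1 by auto
      consider "l = i" | "l = j" | "l \<noteq> i" "l \<noteq> j" by blast
      then have "1 \<le> z y l \<and> z y l \<le> int (N * h)"
      proof cases
        case 1
        have "1 * t y \<le> - a j * t y" "- a j * t y \<le> B * t y"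
          using t0 B1 j by (intro mult_right_mono; linarith)+
        then have "1 \<le> - a j * t y - s y" "- a j * t y - s y \<le> int (N * h)"
          using s[OF yY] t(1)[OF yY] Bt Nh by linarith+
        then show ?thesis using 1 by (simp add: z_def)
      next
        case 2
        have "1 * t y \<le> a i * t y" "a i * t y \<le> B * t y"
          using t0 B1 i by (auto intro!: mult_right_mono)
        then have "1 \<le> a i * t y" "a i * t y \<le> int (N * h)"
          using t0 Bt Nh Bh by linarith+
        then show ?thesis using 2 ij by (simp add: z_def)
      next
        case 3
        have "1 * int (y l) \<le> a i * int (y l)" "a i * int (y l) \<le> B * int h"
          using y[OF yY l] 3 B1 i by (auto intro!: mult_right_mono mult_mono)
        then have "1 \<le> a i * int (y l)" "a i * int (y l) \<le> int (N * h)"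
          using y(1)[OF yY l] 3 Nh Bh by linarith+
        then show ?thesis using 3 by (simp add: z_def)
      qed
      then show "1 \<le> z y l" "z y l \<le> int (N * h)" by auto
    qed
    have \<phi>: "int (\<phi> y l) = z y l" if "y \<in> Y" "l \<in> ?K" for y l
      using z[OF that] that by (simp add: \<phi>_def)
    have "\<phi> y \<in> solutions k a (N * h)" if yY: "y \<in> Y" for y
    proof -
      have "(\<Sum>l\<in>?K. a l * int (\<phi> y l)) = (\<Sum>l\<in>?K. a l * z y l)"
        using \<phi>[OF yY] by (intro sum.cong) auto
      also have "\<dots> = a i * z y i + (a j * z y j + (\<Sum>l\<in>?K - {i, j}. a l * z y l))"
      proof -
        have "?K - {i} - {j} = ?K - {i, j}" by auto
        then show ?thesis
          using sum.remove[of ?K i "\<lambda>l. a l * z y l"] sum.remove[of "?K - {i}" j "\<lambda>l. a l * z y l"] i j ij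
          by simp
      qed
      also have "(\<Sum>l\<in>?K - {i, j}. a l * z y l) = a i * s y"
        unfolding s_def sum_distrib_left by (intro sum.cong) (auto simp: z_def)
      also have "a i * z y i + (a j * z y j + a i * s y) = 0"
        using ij by (simp add: z_def algebra_simps)
      finally have "(\<Sum>l\<in>?K. a l * int (\<phi> y l)) = 0" .
      moreover have "\<phi> y \<in> ?K \<rightarrow>\<^sub>E {1..N * h}"
      proof (rule PiE_I)
        fix l assume l: "l \<in> ?K"
        then have "1 \<le> int (\<phi> y l)" "int (\<phi> y l) \<le> int (N * h)"
          using \<phi>[OF yY l] z[OF yY l] by simp_all
        then show "\<phi> y l \<in> {1..N * h}" unfolding of_nat_le_iff by simp
      qed (simp only: \<phi>_def restrict_def if_False)
      ultimately show ?thesis by (simp add: solutions_def)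
    qed
    moreover have "inj_on \<phi> Y"
    proof (rule inj_onI)
      fix y y' assume Y: "y \<in> Y" "y' \<in> Y" and eq: "\<phi> y = \<phi> y'"
      have "y l = y' l" if l: "l \<in> ?K - {i}" for l
      proof -
        have "z y l = z y' l" using \<phi>[OF Y(1), of l] \<phi>[OF Y(2), of l] eq l by simp
        then show ?thesis using l i by (auto simp: z_def t_def split: if_splits)
      qed
      then show "y = y'"
        using Y unfolding Y_def by (intro PiE_ext[of y "?K - {i}" "\<lambda>_. {1..h}" y'])
    qed
    ultimately have "card Y \<le> card (solutions k a (N * h))"
      using finite_solutions by (intro card_inj_on_le[of \<phi>]) auto
    then show ?thesis using i by (simp add: Y_def card_PiE)
  qed
  then show ?thesis using N by blast
qed

section \<open>The gap for mixed signs and the conclusion\<close>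

lemma min_mono_proportion_le:
  "c \<in> colorings r n \<Longrightarrow> min_mono_proportion k a r n \<le> mono_proportion k a n c"
  unfolding min_mono_proportion_def
  by (intro Min_le) (auto simp: colorings_def finite_PiE)

text \<open>One plus the product of the absolute values works: a common divisor with some
  \<open>a i\<close> divides the product and hence \<open>1\<close>.\<close>

lemma exists_common_coprime:
  fixes a :: "'b \<Rightarrow> int"
  assumes "finite K" "\<And>i. i \<in> K \<Longrightarrow> a i \<noteq> 0"
  shows "\<exists>p\<ge>2. \<forall>i\<in>K. coprime (a i) (int p)"
proof -
  define q where "q = (\<Prod>i\<in>K. \<bar>a i\<bar>)"
  have q: "q \<ge> 1"
    using assms unfolding q_def by (intro prod_ge_1) force
  have "coprime (a i) (1 + q)" if "i \<in> K" for i
  proof (rule coprimeI)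
    fix d assume d: "d dvd a i" "d dvd 1 + q"
    have "a i dvd q"
      using assms(1) that unfolding q_def by (metis abs_dvd_iff dvd_prodI)
    then have "d dvd q" using d dvd_trans by blast
    then show "is_unit d" using d by (metis dvd_add_left_iff)
  qed
  moreover have "int (nat (1 + q)) = 1 + q" "nat (1 + q) \<ge> 2" using q by auto
  ultimately show ?thesis by metis
qed

text \<open>The biased random coloring gains a fixed \<open>\<delta>\<close>. Its error of order
  \<open>n ^ (k - 2)\<close> is divided by at least \<open>h ^ (k - 1)\<close> solutions, which
  leaves a term of order \<open>1 / h\<close>.\<close>

lemma min_mono_proportion_mixed:
  assumes k: "k \<ge> 3" "odd k" and nz: "\<And>i. i \<in> {1..k} \<Longrightarrow> a i \<noteq> 0"
    and i: "i \<in> {1..k}" "a i > 0" and j: "j \<in> {1..k}" "a j < 0" and r: "r \<ge> 3"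
  shows "\<exists>\<delta>>0. \<exists>C. \<exists>N>0. \<forall>h\<ge>1.
           min_mono_proportion k a r (N * h) \<le> real r powi (1 - int k) - \<delta> + C / real h"
proof -
  let ?K = "{1..k}"
  obtain p where p: "p \<ge> 2" "\<And>i. i \<in> ?K \<Longrightarrow> coprime (a i) (int p)"
    using exists_common_coprime[of ?K a] nz by auto
  obtain N where N: "N > 0" "\<And>h. h ^ (k - 1) \<le> card (solutions k a (N * h))"
    using card_solutions_lower[of i k a j] i j by blast
  \<comment> \<open>This keeps all probabilities nonnegative: the smallest, that of color
    \<open>3\<close> on multiples of \<open>p\<close>, is
    \<open>2 * \<epsilon> / real p\<close>.\<close>
  define \<epsilon> where "\<epsilon> = 1 / (2 * real r)"
  \<comment> \<open>The perturbations sum to zero, but since \<open>k\<close> is odd their \<open>k\<close>-th powers sum to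
    \<open>(2 - 2^k) \<epsilon>^k < 0\<close>.\<close>
  define d where "d = (\<lambda>l :: nat. if l = 1 \<or> l = 2 then \<epsilon> else if l = 3 then - 2 * \<epsilon> else 0)"
  \<comment> \<open>Chosen so that \<open>\<beta> l + d l / real p = 1 / real r\<close>: each color
    keeps density \<open>1 / r\<close>, and only the excess term distinguishes the coloring from a
    uniform one.\<close>
  define \<beta> where "\<beta> = (\<lambda>l. 1 / real r - d l / real p)"
  define \<kappa> where "\<kappa> = 1 / real p ^ (k - 1) - 1 / real p ^ k"
  define w where "w = (\<lambda>y l. \<beta> l + (if p dvd y then d l else 0))"
  have \<epsilon>: "\<epsilon> > 0" "2 * \<epsilon> = 1 / real r" using r by (auto simp: \<epsilon>_def)
  have \<kappa>: "\<kappa> > 0"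
  proof -
    have "real p ^ (k - 1) < real p ^ k"
      using p k by (intro power_strict_increasing) auto
    then show ?thesis using p by (simp add: \<kappa>_def frac_less2)
  qed
  have sum3: "(\<Sum>l\<in>{1..r}. f (d l)) = 2 * f \<epsilon> + f (- 2 * \<epsilon>)" if "f 0 = 0" for f :: "real \<Rightarrow> real"
  proof -
    have "(\<Sum>l\<in>{1..r}. f (d l)) = (\<Sum>l\<in>{1, 2, 3}. f (d l))"
      using r that by (intro sum.mono_neutral_right) (auto simp: d_def)
    then show ?thesis by (simp add: d_def)
  qed
  have dsum: "(\<Sum>l\<in>{1..r}. d l) = 0"
    using sum3[of "\<lambda>x. x"] by simp
  have dpow: "(\<Sum>l\<in>{1..r}. d l ^ k) = (2 - 2 ^ k) * \<epsilon> ^ k"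
    using sum3[of "\<lambda>x. x ^ k"] k by (simp add: power_mult_distrib algebra_simps power_minus_odd)
  have w0: "w y l \<ge> 0" for y l
  proof -
    define u where "u = \<epsilon> / real p"
    have u: "0 \<le> u" "2 * u \<le> \<epsilon>"
      using p(1) \<epsilon>(1) by (simp_all add: u_def pos_divide_le_eq mult.commute)
    have "\<beta> l = 2 * \<epsilon> - (if l = 1 \<or> l = 2 then u else if l = 3 then - 2 * u else 0)"
      by (simp add: \<beta>_def d_def u_def \<epsilon>(2))
    then show ?thesis
      using u \<epsilon>(1) by (simp add: w_def d_def)
  qed
  have w1: "(\<Sum>l\<in>{1..r}. w y l) = 1" for y
  proof -
    have "(\<Sum>l\<in>{1..r}. \<beta> l) = 1"
      using r dsum by (simp add: \<beta>_def sum_subtractf flip: sum_divide_distrib)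
    then show ?thesis
      using dsum by (cases "p dvd y") (simp_all add: w_def sum.distrib)
  qed
  have "\<forall>l. \<exists>C. \<forall>n. (\<Sum>x\<in>solutions k a n. \<Prod>i\<in>?K. w (x i) l)
     \<le> ((1 / real r) ^ k + d l ^ k * \<kappa>) * real (card (solutions k a n)) + C * real n ^ (k - 2)"
  proof
    fix l
    have "\<beta> l + d l / real p = 1 / real r" by (simp add: \<beta>_def)
    then show "\<exists>C. \<forall>n. (\<Sum>x\<in>solutions k a n. \<Prod>i\<in>?K. w (x i) l)
     \<le> ((1 / real r) ^ k + d l ^ k * \<kappa>) * real (card (solutions k a n)) + C * real n ^ (k - 2)"
      using weighted_solutions[of k a p "\<beta> l" "d l"] k nz p by (simp add: w_def \<kappa>_def)
  qed
  then obtain C where C: "\<And>l n. (\<Sum>x\<in>solutions k a n. \<Prod>i\<in>?K. w (x i) l)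
     \<le> ((1 / real r) ^ k + d l ^ k * \<kappa>) * real (card (solutions k a n)) + C l * real n ^ (k - 2)"
    by metis
  \<comment> \<open>The absolute value makes the error coefficient nonnegative, so that the number
    of solutions below it can be replaced by its lower bound.\<close>
  define D where "D = \<bar>(\<Sum>l\<in>{1..r}. C l) + real (k\<^sup>2)\<bar>"
  \<comment> \<open>The negative of \<open>\<kappa>\<close> times the sum of the \<open>k\<close>-th
    powers of the perturbations.\<close>
  define \<delta> where "\<delta> = (2 ^ k - 2) * \<epsilon> ^ k * \<kappa>"
  have \<delta>: "\<delta> > 0"
  proof -
    have "(2 :: real) ^ 1 < 2 ^ k" using k by (intro power_strict_increasing) auto
    then show ?thesis using \<epsilon> \<kappa> by (simp add: \<delta>_def)
  qed
  have rk: "real r * (1 / real r) ^ k = real r powi (1 - int k)"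
    using r by (simp add: power_int_diff power_divide)
  have "min_mono_proportion k a r (N * h)
      \<le> real r powi (1 - int k) - \<delta> + D * real N ^ (k - 2) / real h" if h: "h \<ge> 1" for h
  proof -
    let ?n = "N * h" and ?S = "real (card (solutions k a (N * h)))"
    have S: "?S \<ge> real h ^ (k - 1)" using N(2)[of h] by (metis of_nat_le_iff of_nat_power)
    then have S0: "?S > 0" using h by (smt (verit) of_nat_0_less_iff zero_less_power less_le_trans zero_less_one)
    obtain c where c: "c \<in> colorings r ?n" and
      le: "real (card {x \<in> solutions k a ?n. monochromatic k c x})
           \<le> (\<Sum>l\<in>{1..r}. \<Sum>x\<in>solutions k a ?n. \<Prod>i\<in>?K. w (x i) l) + real (k\<^sup>2) * real ?n ^ (k - 2)"
      using exists_coloring_weighted[of k a r w ?n] k nz w0 w1 by blast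
    note le
    also have "(\<Sum>l\<in>{1..r}. \<Sum>x\<in>solutions k a ?n. \<Prod>i\<in>?K. w (x i) l)
        \<le> (\<Sum>l\<in>{1..r}. ((1 / real r) ^ k + d l ^ k * \<kappa>) * ?S + C l * real ?n ^ (k - 2))"
      by (intro sum_mono C)
    also have "\<dots> = (real r * (1 / real r) ^ k + (\<Sum>l\<in>{1..r}. d l ^ k) * \<kappa>) * ?S
        + (\<Sum>l\<in>{1..r}. C l) * real ?n ^ (k - 2)"
      by (simp only: sum.distrib sum_distrib_right[symmetric]) simp
    also have "\<dots> = (real r powi (1 - int k) - \<delta>) * ?S + (\<Sum>l\<in>{1..r}. C l) * real ?n ^ (k - 2)"
      unfolding rk dpow \<delta>_def by (simp add: algebra_simps)
    finally have "real (card {x \<in> solutions k a ?n. monochromatic k c x})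
        \<le> (real r powi (1 - int k) - \<delta>) * ?S + ((\<Sum>l\<in>{1..r}. C l) + real (k\<^sup>2)) * real ?n ^ (k - 2)"
      by (simp only: distrib_right) simp
    also have "\<dots> \<le> (real r powi (1 - int k) - \<delta>) * ?S + D * real ?n ^ (k - 2)"
      unfolding D_def by (intro add_left_mono mult_right_mono) auto
    finally have cnt: "real (card {x \<in> solutions k a ?n. monochromatic k c x})
        \<le> (real r powi (1 - int k) - \<delta>) * ?S + D * real ?n ^ (k - 2)" .
    have "min_mono_proportion k a r ?n \<le> mono_proportion k a ?n c"
      by (rule min_mono_proportion_le[OF c])
    also have "\<dots> \<le> ((real r powi (1 - int k) - \<delta>) * ?S + D * real ?n ^ (k - 2)) / ?S"
      unfolding mono_proportion_def using cnt by (rule divide_right_mono) simp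
    also have "\<dots> = real r powi (1 - int k) - \<delta> + D * real ?n ^ (k - 2) / ?S"
      using S0 by (simp add: add_divide_distrib)
    \<comment> \<open>The lower bound for the number of solutions has one more factor
      \<open>h\<close> than the error.\<close>
    also have "D * real ?n ^ (k - 2) / ?S \<le> D * real ?n ^ (k - 2) / real h ^ (k - 1)"
      using S S0 h by (intro divide_left_mono mult_pos_pos) (auto simp: D_def)
    also have "\<dots> = D * real N ^ (k - 2) / real h"
    proof -
      have "k - 1 = Suc (k - 2)" using k by simp
      then show ?thesis using h by (simp add: power_mult_distrib)
    qed
    finally show ?thesis by simp
  qed
  then show ?thesis using \<delta> N(1) by blast
qed

lemma solutions_same_sign:
  assumes "k \<ge> 1" and "(\<forall>i\<in>{1..k}. a i > 0) \<or> (\<forall>i\<in>{1..k}. a i < 0)"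
  shows "solutions k a n = {}"
proof -
  have False if x: "x \<in> solutions k a n" for x
  proof -
    have x0: "int (x i) > 0" if "i \<in> {1..k}" for i
      using solutions_range[OF x that] by simp
    have eq: "(\<Sum>i\<in>{1..k}. a i * int (x i)) = 0"
      using x by (simp add: solutions_def)
    from assms(2) show False
    proof
      assume "\<forall>i\<in>{1..k}. a i > 0"
      then have "(\<Sum>i\<in>{1..k}. a i * int (x i)) > 0"
        using x0 assms(1) by (intro sum_pos mult_pos_pos) auto
      then show False using eq by simp
    next
      assume "\<forall>i\<in>{1..k}. a i < 0"
      then have "(\<Sum>i\<in>{1..k}. - (a i * int (x i))) > 0"
        using x0 assms(1) by (intro sum_pos) (auto intro: mult_neg_pos)
      then show False using eq by (simp add: sum_negf)
    qed
  qed
  then show ?thesis by blast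
qed

text \<open>Commonness bounds the minimum for all large \<open>n\<close>, so a gap along the
  multiples of \<open>N\<close> refutes it: \<open>\<delta> \<le> e (N * h) + C / real h\<close>
  would hold for all large \<open>h\<close>, and the right-hand side tends to
  \<open>0\<close>.\<close>

lemma uncommon_over_integersI:
  assumes \<delta>: "\<delta> > 0" and N: "N > 0"
    and le: "\<And>h. h \<ge> 1 \<Longrightarrow>
      min_mono_proportion k a r (N * h) \<le> real r powi (1 - int k) - \<delta> + C / real h"
  shows "uncommon_over_integers r k a"
  unfolding uncommon_over_integers_def
proof
  assume "common_over_integers r k a"
  then obtain e where e: "e \<longlonglongrightarrow> 0"
    and ev: "\<forall>\<^sub>F n in sequentially. min_mono_proportion k a r n \<ge> real r powi (1 - int k) - e n"
    by (auto simp: common_over_integers_def)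
  have sub: "filterlim (\<lambda>h. N * h) sequentially sequentially"
    using N by (intro filterlim_subseq) (simp add: strict_mono_def)
  have "(\<lambda>h. e (N * h) + C / real h) \<longlonglongrightarrow> 0 + 0"
    by (intro tendsto_add filterlim_compose[OF e sub] lim_const_over_n)
  moreover have "\<forall>\<^sub>F h in sequentially. \<delta> \<le> e (N * h) + C / real h"
    using eventually_compose_filterlim[OF ev sub] eventually_ge_at_top[of 1]
  proof eventually_elim
    case (elim h)
    then show ?case using le[of h] by linarith
  qed
  ultimately have "\<delta> \<le> 0 + 0"
    by (intro tendsto_lowerbound) auto
  then show False using \<delta> by simp
qed

theorem corollary1p2:
  fixes m :: nat and a :: "nat \<Rightarrow> int"
  assumes "m \<ge> 1"
    and "\<And>i. i \<in> {1..2 * m + 1} \<Longrightarrow> a i \<noteq> 0"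
  shows "\<forall>r::nat. r \<ge> 3 \<longrightarrow> uncommon_over_integers r (2 * m + 1) a"
proof (intro allI impI)
  fix r :: nat assume r: "r \<ge> 3"
  define k where "k = 2 * m + 1"
  have k: "k \<ge> 3" "odd k" using assms(1) by (auto simp: k_def)
  have nz: "\<And>i. i \<in> {1..k} \<Longrightarrow> a i \<noteq> 0" using assms(2) by (simp add: k_def)
  have "uncommon_over_integers r k a"
  proof (cases "(\<forall>i\<in>{1..k}. a i > 0) \<or> (\<forall>i\<in>{1..k}. a i < 0)")
    case True
    \<comment> \<open>Without solutions every proportion is \<open>0 / 0 = 0\<close>, so the gap is
      the full value \<open>real r powi (1 - int k)\<close>; the inequality is written in the shape
      of \<open>uncommon_over_integersI\<close> with \<open>N = 1\<close> and
      \<open>C = 0\<close>.\<close>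
    have "min_mono_proportion k a r (1 * h) \<le> real r powi (1 - int k) - real r powi (1 - int k) + 0 / real h" for h
    proof -
      have "restrict (\<lambda>_. 1) {1..1 * h} \<in> colorings r (1 * h)"
        using r by (auto simp: colorings_def)
      from min_mono_proportion_le[OF this, of k a] show ?thesis
        using solutions_same_sign[of k a h] True k by (simp add: mono_proportion_def)
    qed
    then show ?thesis
      using r by (intro uncommon_over_integersI[of "real r powi (1 - int k)" 1 k a r 0]) auto
  next
    case False
    then obtain i j where "i \<in> {1..k}" "a i > 0" "j \<in> {1..k}" "a j < 0"
      using nz by (metis linorder_neqE)
    then obtain \<delta> C N where "\<delta> > 0" "N > 0" "\<And>h. h \<ge> 1 \<Longrightarrow>
        min_mono_proportion k a r (N * h) \<le> real r powi (1 - int k) - \<delta> + C / real h"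
      using min_mono_proportion_mixed[of k a i j r] k nz r by blast
    then show ?thesis by (rule uncommon_over_integersI)
  qed
  then show "uncommon_over_integers r (2 * m + 1) a" by (simp add: k_def)
qed

end
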